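(* Let $(X,\Delta)$ be a complete $b$-metric space with $X$ nonempty, let $\theta\in\Theta_1$, and let $T:X\to X$ be a mapping that has bounded orbits and satisfies $$\Delta(Tx,Ty)\le\theta\big(\max\{\Delta(x,y),\Delta(x,Tx),\Delta(y,Ty)\}\big)\quad\text{for all }x,y\in X.$$ If $T$ is continuous, or $\Delta$ is separately continuous, then $T$ has a unique fixed point $z$, and for each $x\in X$ the sequence $\{T^nx\}$ converges to $z$.
   Context: A semi-metric on a set $X$ is a function $\Delta:X\times X\to[0,\infty)$ with $\Delta(x,y)=0$ if and only if $x=y$, and $\Delta(x,y)=\Delta(y,x)$ for all $x,y\in X$. A semi-metric $\Delta$ is a $b$-metric if there exists a constant $s\ge1$ such that for all $x,y,z\in X$, $\Delta(x,y)\le s(\Delta(x,z)+\Delta(z,y))$; then $(X,\Delta)$ is called a $b$-metric space. A sequence $\{x_n\}$ converges to $a\in X$ if $\Delta(x_n,a)\to0$. It is Cauchy if for every $\epsilon>0$ there is $m_0\in\mathbb N$ with $\Delta(x_n,x_m)<\epsilon$ for all $n,m>m_0$. $(X,\Delta)$ is complete if every Cauchy sequence converges to a point of $X$. A subset $Y\subset X$ is bounded if there is $M>0$ with $\Delta(x,y)\le M$ for all $x,y\in Y$. $T$ is continuous if $x_n\to x$ implies $Tx_n\to Tx$. $\Delta$ is separately continuous if $\Delta(y_n,y)\to0$ implies $\Delta(x,y_n)\to\Delta(x,y)$ for all $x,y\in X$ and all sequences $(y_n)$ in $X$. The orbit of $x\in X$ under $T$ is the sequence $\{T^nx\}_{n=0}^\infty$,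 with $T^0x=x$, $T^{n+1}x=T(T^nx)$. $T$ has bounded orbits if for every $x\in X$ the set $\{T^nx: n\ge0\}$ is bounded. $\Theta_1$ is the set of non-decreasing functions $\theta:[0,\infty)\to[0,\infty)$ such that $\theta^n(t)\to0$ as $n\to\infty$ for each $t>0$, where $\theta^n$ is the $n$-fold iterate. *)

theory Defs
  imports "HOL-Analysis.Analysis"
begin

text \<open>
  Spaces are given by a carrier set \<open>X\<close> of an arbitrary type; \<open>\<Delta>\<close> and self-maps of \<open>X\<close> are total
  HOL functions of which only the values on \<open>X\<close> matter.
\<close>

definition semi_metric_on :: "'a set \<Rightarrow> ('a \<Rightarrow> 'a \<Rightarrow> real) \<Rightarrow> bool" where
  "semi_metric_on X \<Delta> \<longleftrightarrow>
     (\<forall>x\<in>X. \<forall>y\<in>X. 0 \<le> \<Delta> x y) \<and>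
     (\<forall>x\<in>X. \<forall>y\<in>X. \<Delta> x y = 0 \<longleftrightarrow> x = y) \<and>
     (\<forall>x\<in>X. \<forall>y\<in>X. \<Delta> x y = \<Delta> y x)"

definition b_metric_on :: "'a set \<Rightarrow> ('a \<Rightarrow> 'a \<Rightarrow> real) \<Rightarrow> bool" where
  "b_metric_on X \<Delta> \<longleftrightarrow>
     semi_metric_on X \<Delta> \<and>
     (\<exists>s\<ge>1. \<forall>x\<in>X. \<forall>y\<in>X. \<forall>z\<in>X. \<Delta> x y \<le> s * (\<Delta> x z + \<Delta> z y))"

definition bm_converges :: "('a \<Rightarrow> 'a \<Rightarrow> real) \<Rightarrow> (nat \<Rightarrow> 'a) \<Rightarrow> 'a \<Rightarrow> bool" where
  "bm_converges \<Delta> x a \<longleftrightarrow> (\<lambda>n. \<Delta> (x n) a) \<longlonglongrightarrow> 0"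

definition bm_Cauchy :: "('a \<Rightarrow> 'a \<Rightarrow> real) \<Rightarrow> (nat \<Rightarrow> 'a) \<Rightarrow> bool" where
  "bm_Cauchy \<Delta> x \<longleftrightarrow> (\<forall>\<epsilon>>0. \<exists>m0. \<forall>n>m0. \<forall>m>m0. \<Delta> (x n) (x m) < \<epsilon>)"

definition bm_complete :: "'a set \<Rightarrow> ('a \<Rightarrow> 'a \<Rightarrow> real) \<Rightarrow> bool" where
  "bm_complete X \<Delta> \<longleftrightarrow>
     (\<forall>x. (\<forall>n. x n \<in> X) \<longrightarrow> bm_Cauchy \<Delta> x \<longrightarrow> (\<exists>a\<in>X. bm_converges \<Delta> x a))"

definition bm_bounded :: "('a \<Rightarrow> 'a \<Rightarrow> real) \<Rightarrow> 'a set \<Rightarrow> bool" where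
  "bm_bounded \<Delta> Y \<longleftrightarrow> (\<exists>M>0. \<forall>x\<in>Y. \<forall>y\<in>Y. \<Delta> x y \<le> M)"

definition bounded_orbits_on :: "'a set \<Rightarrow> ('a \<Rightarrow> 'a \<Rightarrow> real) \<Rightarrow> ('a \<Rightarrow> 'a) \<Rightarrow> bool" where
  "bounded_orbits_on X \<Delta> T \<longleftrightarrow> (\<forall>x\<in>X. bm_bounded \<Delta> (range (\<lambda>n. (T ^^ n) x)))"

definition bm_continuous_on :: "'a set \<Rightarrow> ('a \<Rightarrow> 'a \<Rightarrow> real) \<Rightarrow> ('a \<Rightarrow> 'a) \<Rightarrow> bool" where
  "bm_continuous_on X \<Delta> T \<longleftrightarrow>
     (\<forall>x a. (\<forall>n. x n \<in> X) \<longrightarrow> a \<in> X \<longrightarrow> bm_converges \<Delta> x a \<longrightarrow>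
        bm_converges \<Delta> (\<lambda>n. T (x n)) (T a))"

definition separately_continuous_on :: "'a set \<Rightarrow> ('a \<Rightarrow> 'a \<Rightarrow> real) \<Rightarrow> bool" where
  "separately_continuous_on X \<Delta> \<longleftrightarrow>
     (\<forall>x\<in>X. \<forall>y\<in>X. \<forall>ys. (\<forall>n. ys n \<in> X) \<longrightarrow> bm_converges \<Delta> ys y \<longrightarrow>
        (\<lambda>n. \<Delta> x (ys n)) \<longlonglongrightarrow> \<Delta> x y)"

text \<open>Functions on \<open>[0, \<infinity>)\<close> are total functions on the reals, constrained only on \<open>{0..}\<close>.\<close>

definition Theta1 :: "(real \<Rightarrow> real) set" where
  "Theta1 = {\<theta>. \<theta> \<in> {0..} \<rightarrow> {0..} \<and> mono_on {0..} \<theta> \<and>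
                (\<forall>t>0. (\<lambda>n. (\<theta> ^^ n) t) \<longlonglongrightarrow> 0)}"

end

theory Submission
  imports Defs
begin

text \<open>
  If an orbit has diameter at most \<open>M\<close>, then the contractive condition, applied inside the tails of
  the orbit, bounds the diameter of its \<open>n\<close>-th tail by \<open>\<theta>\<^sup>n(M)\<close>. Hence every orbit is Cauchy and
  converges to some \<open>z\<close>. If \<open>T\<close> is continuous, \<open>z\<close> is fixed by uniqueness of limits. If \<open>\<Delta>\<close> is
  separately continuous and \<open>r = \<Delta>(z, Tz) > 0\<close>, then for large \<open>n\<close> the maximum in the contractive
  condition for \<open>T\<^sup>nx\<close> and \<open>z\<close> equals \<open>r\<close>, and letting \<open>n \<rightarrow> \<infinity>\<close> gives \<open>r \<le> \<theta>(r) < r\<close>.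
\<close>

lemma Theta1_nonneg: "\<theta> \<in> Theta1 \<Longrightarrow> 0 \<le> t \<Longrightarrow> 0 \<le> \<theta> t"
  by (auto simp: Theta1_def)

lemma Theta1_mono: "\<theta> \<in> Theta1 \<Longrightarrow> 0 \<le> s \<Longrightarrow> s \<le> t \<Longrightarrow> \<theta> s \<le> \<theta> t"
  by (auto simp: Theta1_def intro: mono_onD)

lemma Theta1_tendsto: "\<theta> \<in> Theta1 \<Longrightarrow> 0 < t \<Longrightarrow> (\<lambda>n. (\<theta> ^^ n) t) \<longlonglongrightarrow> 0"
  by (simp add: Theta1_def)

text \<open>If \<open>t \<le> \<theta> t\<close>, monotonicity keeps every iterate
  \<open>(\<theta> ^^ n) t\<close> at or above \<open>t\<close>, so the iterates could not tend to
  0.\<close>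

lemma Theta1_less:
  assumes \<theta>: "\<theta> \<in> Theta1" and "0 < t"
  shows "\<theta> t < t"
proof (rule ccontr)
  assume "\<not> \<theta> t < t"
  have "t \<le> (\<theta> ^^ n) t" for n
  proof (induction n)
    case (Suc n)
    have "t \<le> \<theta> t"
      using \<open>\<not> \<theta> t < t\<close> by simp
    also have "\<dots> \<le> \<theta> ((\<theta> ^^ n) t)"
      using Suc \<open>0 < t\<close> by (intro Theta1_mono[OF \<theta>]) auto
    finally show ?case by simp
  qed simp
  then have "t \<le> 0"
    by (intro LIMSEQ_le_const[OF Theta1_tendsto[OF \<theta> \<open>0 < t\<close>]]) auto
  then show False using \<open>0 < t\<close> by simp
qed

lemma b_metric_on_nonneg: "b_metric_on X \<Delta> \<Longrightarrow> x \<in> X \<Longrightarrow> y \<in> X \<Longrightarrow> 0 \<le> \<Delta> x y"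
  by (simp add: b_metric_on_def semi_metric_on_def)

lemma b_metric_on_zero_iff:
  "b_metric_on X \<Delta> \<Longrightarrow> x \<in> X \<Longrightarrow> y \<in> X \<Longrightarrow> \<Delta> x y = 0 \<longleftrightarrow> x = y"
  by (simp add: b_metric_on_def semi_metric_on_def)

lemma b_metric_on_sym: "b_metric_on X \<Delta> \<Longrightarrow> x \<in> X \<Longrightarrow> y \<in> X \<Longrightarrow> \<Delta> x y = \<Delta> y x"
  unfolding b_metric_on_def semi_metric_on_def by metis

text \<open>The relaxed triangle inequality through \<open>x n\<close> bounds the fixed number
  \<open>\<Delta> a c\<close> by a null sequence, so no continuity of \<open>\<Delta>\<close>
  enters.\<close>

lemma bm_converges_unique:
  assumes b: "b_metric_on X \<Delta>"
    and X: "\<And>n. x n \<in> X" "a \<in> X" "c \<in> X"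
    and conv: "bm_converges \<Delta> x a" "bm_converges \<Delta> x c"
  shows "a = c"
proof -
  obtain s where s: "\<And>u v w. u \<in> X \<Longrightarrow> v \<in> X \<Longrightarrow> w \<in> X \<Longrightarrow> \<Delta> u v \<le> s * (\<Delta> u w + \<Delta> w v)"
    using b unfolding b_metric_on_def by blast
  have le: "\<Delta> a c \<le> s * (\<Delta> (x n) a + \<Delta> (x n) c)" for n
    using s[of a c "x n"] b_metric_on_sym[OF b, of a "x n"] X by simp
  have "(\<lambda>n. s * (\<Delta> (x n) a + \<Delta> (x n) c)) \<longlonglongrightarrow> s * (0 + 0)"
    using conv unfolding bm_converges_def by (intro tendsto_intros)
  then have "\<Delta> a c \<le> s * (0 + 0)"
    by (rule LIMSEQ_le_const) (use le in auto)
  then show ?thesis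
    using b_metric_on_nonneg[OF b, of a c] b_metric_on_zero_iff[OF b, of a c] X by simp
qed

locale max_contraction =
  fixes X :: "'a set" and \<Delta> :: "'a \<Rightarrow> 'a \<Rightarrow> real"
    and \<theta> :: "real \<Rightarrow> real" and T :: "'a \<Rightarrow> 'a"
  assumes b_metric: "b_metric_on X \<Delta>"
    and \<theta>: "\<theta> \<in> Theta1"
    and T: "T \<in> X \<rightarrow> X"
    and contr: "\<And>x y. x \<in> X \<Longrightarrow> y \<in> X \<Longrightarrow>
           \<Delta> (T x) (T y) \<le> \<theta> (Max {\<Delta> x y, \<Delta> x (T x), \<Delta> y (T y)})"
begin

lemmas nonneg = b_metric_on_nonneg[OF b_metric]
  and zero_iff = b_metric_on_zero_iff[OF b_metric]
  and sym = b_metric_on_sym[OF b_metric]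

lemma T_in: "x \<in> X \<Longrightarrow> T x \<in> X"
  using T by auto

lemma orbit_in: "x \<in> X \<Longrightarrow> (T ^^ n) x \<in> X"
  by (induction n) (auto simp: T_in)

text \<open>Monotonicity of \<open>\<theta>\<close> lets any common upper bound \<open>r\<close> of
  the three distances replace their maximum; this is the form in which the contractive condition is
  applied below.\<close>

lemma contr_le:
  assumes "x \<in> X" "y \<in> X" "\<Delta> x y \<le> r" "\<Delta> x (T x) \<le> r" "\<Delta> y (T y) \<le> r"
  shows "\<Delta> (T x) (T y) \<le> \<theta> r"
proof -
  have "\<Delta> (T x) (T y) \<le> \<theta> (Max {\<Delta> x y, \<Delta> x (T x), \<Delta> y (T y)})"
    using assms by (intro contr)
  also have "\<dots> \<le> \<theta> r"
    using assms nonneg by (intro Theta1_mono[OF \<theta>]) (auto simp: le_max_iff_disj)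
  finally show ?thesis .
qed

text \<open>At fixed points both displacement terms vanish, so the maximum is the distance
  \<open>\<Delta> w z\<close> itself, and \<open>\<theta> t < t\<close> rules out a positive
  value.\<close>

lemma fixed_point_unique:
  assumes "z \<in> X" "w \<in> X" "T z = z" "T w = w"
  shows "w = z"
proof -
  have "\<Delta> w z \<le> \<theta> (\<Delta> w z)"
    using contr_le[of w z "\<Delta> w z"] assms nonneg[of w z] zero_iff[of w w] zero_iff[of z z] by simp
  then have "\<not> 0 < \<Delta> w z"
    using Theta1_less[OF \<theta>, of "\<Delta> w z"] by auto
  then show ?thesis
    using nonneg[of w z] zero_iff[of w z] assms by auto
qed

lemma orbit_tail_diameter_le:
  assumes "x \<in> X" and M: "\<And>i j. \<Delta> ((T ^^ i) x) ((T ^^ j) x) \<le> M"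
  shows "n \<le> i \<Longrightarrow> n \<le> j \<Longrightarrow> \<Delta> ((T ^^ i) x) ((T ^^ j) x) \<le> (\<theta> ^^ n) M"
proof (induction n arbitrary: i j)
  case 0
  then show ?case using M by simp
next
  case (Suc n)
  \<comment> \<open>Both indices are positive, so both points are images under \<open>T\<close> of
    points of the \<open>n\<close>-th tail.\<close>
  obtain i' j' where ij: "i = Suc i'" "j = Suc j'"
    using Suc.prems by (metis Suc_le_D)
  have tail: "\<Delta> ((T ^^ k) x) ((T ^^ l) x) \<le> (\<theta> ^^ n) M" if "n \<le> k" "n \<le> l" for k l
    using Suc.IH that .
  \<comment> \<open>The maximum only involves points with indices \<open>i'\<close>,
    \<open>j'\<close>, \<open>Suc i'\<close> and \<open>Suc j'\<close>, all at least
    \<open>n\<close>, so the induction hypothesis bounds each of the three distances.\<close>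
  have "\<Delta> (T ((T ^^ i') x)) (T ((T ^^ j') x)) \<le> \<theta> ((\<theta> ^^ n) M)"
    using tail[of i' j'] tail[of i' "Suc i'"] tail[of j' "Suc j'"] Suc.prems ij
      orbit_in[OF \<open>x \<in> X\<close>]
    by (intro contr_le) auto
  then show ?case using ij by simp
qed

lemma orbit_Cauchy:
  assumes "x \<in> X" and "bounded_orbits_on X \<Delta> T"
  shows "bm_Cauchy \<Delta> (\<lambda>n. (T ^^ n) x)"
  unfolding bm_Cauchy_def
proof (intro allI impI)
  fix \<epsilon> :: real assume "0 < \<epsilon>"
  obtain M where "0 < M" and M: "\<And>i j. \<Delta> ((T ^^ i) x) ((T ^^ j) x) \<le> M"
    using assms by (auto simp: bounded_orbits_on_def bm_bounded_def)
  \<comment> \<open>A single small iterate suffices: it bounds the diameter of the whole tail from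
    \<open>m0\<close> on.\<close>
  from order_tendstoD(2)[OF Theta1_tendsto[OF \<theta> \<open>0 < M\<close>] \<open>0 < \<epsilon>\<close>]
  obtain m0 where "(\<theta> ^^ m0) M < \<epsilon>"
    by (auto simp: eventually_sequentially)
  then have "\<Delta> ((T ^^ n) x) ((T ^^ m) x) < \<epsilon>" if "n > m0" "m > m0" for n m
    using orbit_tail_diameter_le[OF assms(1) M, of m0 n m] that by simp
  then show "\<exists>m0. \<forall>n>m0. \<forall>m>m0. \<Delta> ((T ^^ n) x) ((T ^^ m) x) < \<epsilon>"
    by blast
qed

lemma orbit_limit_fixed:
  assumes "x \<in> X" "z \<in> X" and bdd: "bounded_orbits_on X \<Delta> T"
    and lim: "bm_converges \<Delta> (\<lambda>n. (T ^^ n) x) z"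
    and cont: "bm_continuous_on X \<Delta> T \<or> separately_continuous_on X \<Delta>"
  shows "T z = z"
proof -
  have inX: "\<And>n. (T ^^ n) x \<in> X" "T z \<in> X"
    using assms orbit_in T_in by auto
  have lim_Suc: "bm_converges \<Delta> (\<lambda>n. (T ^^ Suc n) x) z"
    using LIMSEQ_Suc[OF lim[unfolded bm_converges_def]] unfolding bm_converges_def .
  from cont show ?thesis
  proof
    assume "bm_continuous_on X \<Delta> T"
    \<comment> \<open>Applying \<open>T\<close> termwise shifts the orbit by one, and the shifted
      orbit also converges to \<open>z\<close>.\<close>
    then have "bm_converges \<Delta> (\<lambda>n. (T ^^ Suc n) x) (T z)"
      using lim inX \<open>z \<in> X\<close> unfolding bm_continuous_on_def by simp
    then show ?thesis
      using bm_converges_unique[OF b_metric _ _ _ _ lim_Suc] inX \<open>z \<in> X\<close> orbit_in[OF \<open>x \<in> X\<close>]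
      by blast
  next
    assume sep: "separately_continuous_on X \<Delta>"
    show ?thesis
    proof (rule ccontr)
      assume "T z \<noteq> z"
      define r where "r = \<Delta> z (T z)"
      have "0 < r"
        using nonneg[of z "T z"] zero_iff[of z "T z"] inX \<open>z \<in> X\<close> \<open>T z \<noteq> z\<close>
        by (auto simp: r_def)
      have near: "\<forall>\<^sub>F n in sequentially. \<Delta> ((T ^^ n) x) z < r"
        using order_tendstoD(2)[OF lim[unfolded bm_converges_def] \<open>0 < r\<close>] .
      obtain m0 where m0: "\<And>n m. m0 < n \<Longrightarrow> m0 < m \<Longrightarrow> \<Delta> ((T ^^ n) x) ((T ^^ m) x) < r"
        using orbit_Cauchy[OF \<open>x \<in> X\<close> bdd] \<open>0 < r\<close> unfolding bm_Cauchy_def by blast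
      \<comment> \<open>For large \<open>n\<close> the three distances are at most \<open>r\<close>:
        the first by convergence to \<open>z\<close>, the second by the Cauchy property, and the
        third is \<open>r\<close> itself.\<close>
      have bound: "\<forall>\<^sub>F n in sequentially. \<Delta> (T z) ((T ^^ Suc n) x) \<le> \<theta> r"
        using near eventually_gt_at_top[of m0]
      proof eventually_elim
        case (elim n)
        have "\<Delta> (T ((T ^^ n) x)) (T z) \<le> \<theta> r"
          using elim m0[of n "Suc n"] inX \<open>z \<in> X\<close>
          by (intro contr_le) (auto simp: r_def)
        then show ?case
          using sym[of "T z" "(T ^^ Suc n) x"] inX orbit_in[OF \<open>x \<in> X\<close>, of "Suc n"] by simp
      qed
      \<comment> \<open>Separate continuity is used with \<open>T z\<close> held fixed, which is why
        \<open>bound\<close> has \<open>T z\<close> as its first argument.\<close>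
      have "(\<lambda>n. \<Delta> (T z) ((T ^^ Suc n) x)) \<longlonglongrightarrow> \<Delta> (T z) z"
        using sep[unfolded separately_continuous_on_def, rule_format, OF inX(2) \<open>z \<in> X\<close> _ lim_Suc]
          orbit_in[OF \<open>x \<in> X\<close>] .
      then have "\<Delta> (T z) z \<le> \<theta> r"
        using bound by (rule tendsto_upperbound) simp
      then show False
        using Theta1_less[OF \<theta> \<open>0 < r\<close>] sym[of z "T z"] inX \<open>z \<in> X\<close> by (simp add: r_def)
    qed
  qed
qed

end

theorem corollary3:
  fixes X :: "'a set" and \<Delta> :: "'a \<Rightarrow> 'a \<Rightarrow> real"
    and \<theta> :: "real \<Rightarrow> real" and T :: "'a \<Rightarrow> 'a"
  assumes "X \<noteq> {}"
    and "b_metric_on X \<Delta>"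
    and "bm_complete X \<Delta>"
    and "\<theta> \<in> Theta1"
    and "T \<in> X \<rightarrow> X"
    and "bounded_orbits_on X \<Delta> T"
    and "\<And>x y. x \<in> X \<Longrightarrow> y \<in> X \<Longrightarrow>
           \<Delta> (T x) (T y) \<le> \<theta> (Max {\<Delta> x y, \<Delta> x (T x), \<Delta> y (T y)})"
    and "bm_continuous_on X \<Delta> T \<or> separately_continuous_on X \<Delta>"
  shows "\<exists>z\<in>X. T z = z \<and> (\<forall>w\<in>X. T w = w \<longrightarrow> w = z) \<and>
           (\<forall>x\<in>X. bm_converges \<Delta> (\<lambda>n. (T ^^ n) x) z)"
proof -
  interpret max_contraction X \<Delta> \<theta> T
    using assms(2,4,5,7) by (rule max_contraction.intro)
  have lim: "\<exists>z\<in>X. T z = z \<and> bm_converges \<Delta> (\<lambda>n. (T ^^ n) x) z" if x: "x \<in> X" for x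
  proof -
    obtain z where "z \<in> X" "bm_converges \<Delta> (\<lambda>n. (T ^^ n) x) z"
      using assms(3)[unfolded bm_complete_def, rule_format, OF orbit_in[OF x]
          orbit_Cauchy[OF x assms(6)]] by auto
    then show ?thesis
      using orbit_limit_fixed[OF x _ assms(6) _ assms(8)] by blast
  qed
  obtain z where z: "z \<in> X" "T z = z"
    using assms(1) lim by blast
  \<comment> \<open>Each orbit converges to some fixed point, which uniqueness identifies with the
    \<open>z\<close> already chosen.\<close>
  have "bm_converges \<Delta> (\<lambda>n. (T ^^ n) x) z" if "x \<in> X" for x
    using lim[OF that] fixed_point_unique z by metis
  then show ?thesis
    using z fixed_point_unique by blast
qed

end
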